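(* Let $s, k, e_1, \ldots, e_s$ be integers, all at least $2$, such that $k < v$, where $v := \prod_{i=1}^s e_i$. Let $\mathscr{P}$ be a set of size $v$ and let $\mathscr{C}_0\prec\mathscr{C}_1\prec\cdots\prec\mathscr{C}_s$ be a chain of partitions of $\mathscr{P}$, where $\mathscr{C}_0$ is the partition into singletons and $\mathscr{C}_s=\{\mathscr{P}\}$, such that for $1 \leq i \leq s$ each class of $\mathscr{C}_i$ contains exactly $e_i$ classes of $\mathscr{C}_{i-1}$. Let $d := \gcd(e_1 - 1, \ldots, e_s - 1)$, and for each $i \in \{1, \ldots, s\}$ let $$y_i := 1 + \frac{k-1}{v-1} \left( \left(\prod_{j=1}^i e_j\right) - 1 \right)$$ (so $y_s=k$). Then there exist a $2$-$(v,k,\lambda)$ design $\mathscr{D}$ with point set $\mathscr{P}$, for some $\lambda$, and a group $G\leq \mathrm{Aut}(\mathscr{D})$ such that $G$ is flag-transitive on $\mathscr{D}$ and preserves each of the partitions $\mathscr{C}_0,\dots,\mathscr{C}_s$, if and only if the following conditions both hold: (FT1) $v-1$ divides $(k-1)d$; and (FT2) for each $i \in \{1, \ldots, s-1\}$, $y_{i}$ is a positive integer dividing $(e_{i+1} - 1)\left(\prod_{j=1}^{i} e_j\right)/d$. Moreover, if (FT1) and (FT2) hold and $\mathscr{D} = (\mathscr{P},\mathscr{B})$ is such a design (that is, a $2$-$(v,k,\lambda)$ design for some $\lambda$ admitting a flag-transitive group of automorphisms preserving each $\mathscr{C}_i$) then, for each $i \in \{1, \ldots, s\}$, each class $C \in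 \mathscr{C}_i$ and each block $B \in \mathscr{B}$, $|B \cap C| \in \{0,y_i\}$.
   Context: A $2$-$(v,k,\lambda)$ design is a pair $\mathscr{D}=(\mathscr{P},\mathscr{B})$ where $\mathscr{P}$ is a set of $v$ points, $\mathscr{B}$ is a nonempty set of $k$-element subsets of $\mathscr{P}$ (blocks), and any two distinct points are contained in exactly $\lambda$ blocks. $\mathrm{Aut}(\mathscr{D})$ is the group of permutations of $\mathscr{P}$ that map $\mathscr{B}$ to itself. A flag is a pair $(\delta,B)\in\mathscr{P}\times\mathscr{B}$ with $\delta\in B$; $G\le\mathrm{Aut}(\mathscr{D})$ is flag-transitive if it is transitive on the set of flags. For partitions of $\mathscr{P}$, $\mathscr{C}\prec\mathscr{C}'$ means that each $\mathscr{C}$-class is a proper subset of some $\mathscr{C}'$-class. $G$ preserves a partition if it permutes its classes. *)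

theory Defs
  imports Complex_Main "HOL-Library.Disjoint_Sets" "HOL-Algebra.Bij"
begin

definition two_design :: "'a set \<Rightarrow> 'a set set \<Rightarrow> nat \<Rightarrow> nat \<Rightarrow> nat \<Rightarrow> bool" where
  "two_design P \<B> v k lam \<longleftrightarrow>
     finite P \<and> card P = v \<and> \<B> \<noteq> {} \<and>
     (\<forall>B\<in>\<B>. B \<subseteq> P \<and> card B = k) \<and>
     (\<forall>x\<in>P. \<forall>y\<in>P. x \<noteq> y \<longrightarrow> card {B \<in> \<B>. x \<in> B \<and> y \<in> B} = lam)"

(* As in BijGroup, a permutation of P is represented by a function that is undefined outside P. *)
definition design_Aut :: "'a set \<Rightarrow> 'a set set \<Rightarrow> ('a \<Rightarrow> 'a) monoid" where
  "design_Aut P \<B> = (BijGroup P)\<lparr>carrier := {g \<in> Bij P. (`) g ` \<B> = \<B>}\<rparr>"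

definition flags :: "'a set \<Rightarrow> 'a set set \<Rightarrow> ('a \<times> 'a set) set" where
  "flags P \<B> = {(x, B). x \<in> P \<and> B \<in> \<B> \<and> x \<in> B}"

definition flag_transitive :: "('a \<Rightarrow> 'a) set \<Rightarrow> 'a set \<Rightarrow> 'a set set \<Rightarrow> bool" where
  "flag_transitive G P \<B> \<longleftrightarrow>
     (\<forall>(x, B) \<in> flags P \<B>. \<forall>(x', B') \<in> flags P \<B>. \<exists>g\<in>G. g x = x' \<and> g ` B = B')"

definition partition_less :: "'a set set \<Rightarrow> 'a set set \<Rightarrow> bool" where
  "partition_less \<C> \<C>' \<longleftrightarrow> (\<forall>X\<in>\<C>. \<exists>Y\<in>\<C>'. X \<subset> Y)"

definition preserves_partition :: "('a \<Rightarrow> 'a) set \<Rightarrow> 'a set set \<Rightarrow> bool" where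
  "preserves_partition G \<C> \<longleftrightarrow> (\<forall>g\<in>G. bij_betw ((`) g) \<C> \<C>)"

(* C i is the i-th partition of the chain, 0 <= i <= s; e i is the number of classes of
   C (i - 1) in each class of C i, 1 <= i <= s. *)
definition partition_chain :: "'a set \<Rightarrow> nat \<Rightarrow> (nat \<Rightarrow> nat) \<Rightarrow> (nat \<Rightarrow> 'a set set) \<Rightarrow> bool" where
  "partition_chain P s e C \<longleftrightarrow>
     (\<forall>i\<in>{0..s}. partition_on P (C i)) \<and>
     C 0 = {{x} | x. x \<in> P} \<and> C s = {P} \<and>
     (\<forall>i\<in>{1..s}. partition_less (C (i - 1)) (C i)) \<and>
     (\<forall>i\<in>{1..s}. \<forall>X \<in> C i. card {Y \<in> C (i - 1). Y \<subseteq> X} = e i)"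

definition FT1 :: "nat \<Rightarrow> nat \<Rightarrow> nat \<Rightarrow> bool" where
  "FT1 v k d \<longleftrightarrow> (v - 1) dvd ((k - 1) * d)"

(* The division is exact where d is the gcd of e 1 - 1, ..., e s - 1. *)
definition FT2 :: "nat \<Rightarrow> (nat \<Rightarrow> nat) \<Rightarrow> nat \<Rightarrow> (nat \<Rightarrow> real) \<Rightarrow> bool" where
  "FT2 s e d y \<longleftrightarrow>
     (\<forall>i\<in>{1..s - 1}. \<exists>m::nat. m > 0 \<and> y i = real m \<and>
        m dvd ((e (i + 1) - 1) * (\<Prod>j=1..i. e j)) div d)"

lemma group_design_Aut:
  assumes "\<forall>B\<in>\<B>. B \<subseteq> P"
  shows "group (design_Aut P \<B>)"
proof -
  have comp: "(`) (compose P g h) ` \<B> = (`) g ` ((`) h ` \<B>)" for g h :: "'a \<Rightarrow> 'a"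
  proof -
    have "compose P g h ` B = g ` h ` B" if "B \<in> \<B>" for B
      using assms that by (force simp: compose_def image_image)
    then show ?thesis
      by (simp add: image_image)
  qed
  have one: "(`) (\<lambda>x\<in>P. x) ` \<B> = \<B>"
  proof -
    have "(\<lambda>x\<in>P. x) ` B = B" if "B \<in> \<B>" for B
      using assms that by force
    then show ?thesis by simp
  qed
  have "subgroup {g \<in> Bij P. (`) g ` \<B> = \<B>} (BijGroup P)"
  proof (rule group.subgroupI[OF group_BijGroup])
    show "{g \<in> Bij P. (`) g ` \<B> = \<B>} \<noteq> {}"
      using one id_Bij by blast
  next
    fix g assume g: "g \<in> {g \<in> Bij P. (`) g ` \<B> = \<B>}"
    let ?h = "\<lambda>x\<in>P. (inv_into P g) x"
    have h: "?h \<in> Bij P"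
      using g by (simp add: restrict_inv_into_Bij)
    have "compose P ?h g = (\<lambda>x\<in>P. x)"
      using g by (simp add: Bij_compose_restrict_eq)
    then have "(`) ?h ` \<B> = \<B>"
      using comp[of ?h g] one g by simp
    then show "inv\<^bsub>BijGroup P\<^esub> g \<in> {g \<in> Bij P. (`) g ` \<B> = \<B>}"
      using g h by (simp add: inv_BijGroup)
  qed (auto simp: BijGroup_def compose_Bij comp)
  then show ?thesis
    unfolding design_Aut_def by (rule group.subgroup_imp_group[OF group_BijGroup])
qed

end

theory Submission
  imports Defs
begin

text \<open>
  Write \<open>c i = e 1 * ... * e i\<close> for the size of a class of \<open>C i\<close>. Flag-transitivity makes the
  nonzero sizes \<open>card (B \<inter> X)\<close> with \<open>X \<in> C i\<close> a constant \<open>Y i\<close>, and counting the flags \<open>(z, B)\<close>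
  with \<open>z\<close> in the class of a fixed point of \<open>B\<close> gives
  \<open>(v - 1) * (Y i - 1) = (k - 1) * (c i - 1)\<close>, so \<open>Y i\<close> is the number \<open>y i\<close>. Since a class of
  \<open>C (i + 1)\<close> meeting \<open>B\<close> is a union of classes meeting \<open>B\<close> in \<open>Y i\<close> or no points, \<open>Y i\<close>
  divides \<open>Y (i + 1)\<close>. The two arithmetic conditions are equivalent to these divisibilities, because
  \<open>Y i\<close> is congruent to 1 modulo \<open>T = (k - 1) * d / (v - 1)\<close>.

  Conversely, take as blocks all sets that meet each class of \<open>C i\<close> in \<open>0\<close> or \<open>Y i\<close> points, and as
  group all permutations preserving the partitions. Partial level-preserving maps between two
  such sets extend one point at a time; as \<open>P\<close> itself is a set of this kind (with \<open>Y = c\<close>), the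
  group is transitive on flags and on the pairs of points first joined at a given level.
  Counting the blocks through a point then shows that the number of blocks through two points
  does not depend on that level.
\<close>

section \<open>Two counting lemmas\<close>

text \<open>Double counting of the pairs \<open>(z, B)\<close> with \<open>z\<close> in
  \<open>S\<close> and \<open>B\<close> a block through \<open>x\<close>. It serves once with
  \<open>S\<close> a cell without its base point and once with \<open>S\<close> a difference of two
  nested cells.\<close>

lemma sum_card_blocks:
  assumes "finite \<B>" "finite S"
  shows "(\<Sum>z\<in>S. card {B \<in> \<B>. x \<in> B \<and> z \<in> B}) = (\<Sum>B\<in>{B \<in> \<B>. x \<in> B}. card (B \<inter> S))"
proof -
  have "(\<Sum>z\<in>S. card {B \<in> \<B>. x \<in> B \<and> z \<in> B})
      = (\<Sum>z\<in>S. \<Sum>B\<in>{B \<in> \<B>. x \<in> B}. if z \<in> B then 1 else 0)"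
  proof (rule sum.cong)
    fix z
    have "{B \<in> \<B>. x \<in> B \<and> z \<in> B} = {B \<in> {B \<in> \<B>. x \<in> B}. z \<in> B}" by auto
    then show "card {B \<in> \<B>. x \<in> B \<and> z \<in> B} = (\<Sum>B\<in>{B \<in> \<B>. x \<in> B}. if z \<in> B then 1 else 0)"
      using assms(1) by (simp add: sum.If_cases Int_def)
  qed simp
  also have "\<dots> = (\<Sum>B\<in>{B \<in> \<B>. x \<in> B}. \<Sum>z\<in>S. if z \<in> B then 1 else 0)"
    by (rule sum.swap)
  also have "\<dots> = (\<Sum>B\<in>{B \<in> \<B>. x \<in> B}. card (B \<inter> S))"
    using assms(2) by (intro sum.cong) (auto simp: sum.If_cases Int_def conj_commute)
  finally show ?thesis .
qed

text \<open>Both images are in bijection with the classes of the common kernel on \<open>A\<close>.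
  This compares the number of cells met by a set with the number met by its image under a
  level-preserving map.\<close>

lemma card_image_same_kernel:
  assumes "\<And>x y. x \<in> A \<Longrightarrow> y \<in> A \<Longrightarrow> f x = f y \<longleftrightarrow> g x = g y"
  shows "card (f ` A) = card (g ` A)"
proof -
  have eq: "g (inv_into A f (f x)) = g x" if "x \<in> A" for x
    using assms[of "inv_into A f (f x)" x] that by (simp add: f_inv_into_f inv_into_into)
  have "inj_on (g \<circ> inv_into A f) (f ` A)"
    by (rule inj_onI) (use eq assms in auto)
  moreover have "(g \<circ> inv_into A f) ` (f ` A) = g ` A"
    using eq by (auto simp: image_image cong: image_cong_simp)
  ultimately show ?thesis by (metis card_image)
qed

section \<open>Cells and uniform sets\<close>

locale partition_tower =
  fixes P :: "'a set" and s :: nat and e :: "nat \<Rightarrow> nat" and C :: "nat \<Rightarrow> 'a set set"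
  assumes finite_P: "finite P" and chain: "partition_chain P s e C"
begin

text \<open>For \<open>i \<le> s\<close> this union is the class of \<open>x\<close> if
  \<open>x\<close> lies in \<open>P\<close>, and is empty otherwise, so that bounds such as
  \<open>cell_subset\<close> need no hypothesis on \<open>x\<close>.\<close>

definition cell :: "nat \<Rightarrow> 'a \<Rightarrow> 'a set" where
  "cell i x = \<Union>{X \<in> C i. x \<in> X}"

lemma partition_on_level: "i \<le> s \<Longrightarrow> partition_on P (C i)"
  using chain unfolding partition_chain_def by auto

lemma cell_eq:
  assumes "i \<le> s" "X \<in> C i" "x \<in> X"
  shows "cell i x = X"
proof -
  have "{Z \<in> C i. x \<in> Z} = {X}"
    using partition_onD2[OF partition_on_level[OF assms(1)]] assms
    by (auto simp: disjoint_def)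
  then show ?thesis by (simp add: cell_def)
qed

lemma cell_in_level:
  assumes "i \<le> s" "x \<in> P"
  shows "cell i x \<in> C i" and "x \<in> cell i x"
proof -
  obtain X where "X \<in> C i" "x \<in> X"
    using partition_onD1[OF partition_on_level[OF assms(1)]] assms(2) by auto
  then show "cell i x \<in> C i" "x \<in> cell i x"
    using cell_eq[OF assms(1)] by auto
qed

lemma level_subset: "i \<le> s \<Longrightarrow> X \<in> C i \<Longrightarrow> X \<subseteq> P"
  using partition_onD1[OF partition_on_level] by auto

lemma level_cellE:
  assumes "i \<le> s" "X \<in> C i"
  obtains x where "x \<in> P" "x \<in> X" "X = cell i x"
proof -
  have "X \<noteq> {}"
    using partition_onD3[OF partition_on_level[OF assms(1)]] assms(2) by auto
  then show ?thesis
    using that cell_eq[OF assms] level_subset[OF assms] by auto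
qed

lemma cell_subset: "i \<le> s \<Longrightarrow> cell i x \<subseteq> P"
  using level_subset by (fastforce simp: cell_def)

lemma finite_cell: "i \<le> s \<Longrightarrow> finite (cell i x)"
  using cell_subset finite_P finite_subset by metis

lemma mem_cell_iff:
  assumes "i \<le> s" "x \<in> P" "z \<in> P"
  shows "z \<in> cell i x \<longleftrightarrow> cell i z = cell i x"
  using assms cell_eq cell_in_level by metis

lemma cell_Suc_mono:
  assumes "Suc i \<le> s" "x \<in> P"
  shows "cell i x \<subseteq> cell (Suc i) x"
proof -
  have "partition_less (C i) (C (Suc i))"
    using chain assms(1) unfolding partition_chain_def by (auto dest!: bspec[of _ _ "Suc i"])
  moreover have "cell i x \<in> C i" "x \<in> cell i x"
    using cell_in_level assms by auto
  ultimately obtain Y where "Y \<in> C (Suc i)" "cell i x \<subset> Y"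
    unfolding partition_less_def by blast
  then show ?thesis
    using cell_eq[OF assms(1)] \<open>x \<in> cell i x\<close> by blast
qed

lemma cell_mono:
  assumes "i \<le> j" "j \<le> s" "x \<in> P"
  shows "cell i x \<subseteq> cell j x"
  using assms
proof (induction j rule: dec_induct)
  case base
  then show ?case by simp
next
  case (step n)
  then show ?case using cell_Suc_mono[of n x] by auto
qed

lemma cell_0: "x \<in> P \<Longrightarrow> cell 0 x = {x}"
  using chain cell_eq[of 0 "{x}" x] unfolding partition_chain_def by auto

lemma cell_top: "x \<in> P \<Longrightarrow> cell s x = P"
  using chain cell_eq[of s P x] unfolding partition_chain_def by auto

text \<open>A class that meets \<open>U\<close> is the cell of a point of \<open>U\<close>, so the
  last clause says that every class of level \<open>i\<close> meets \<open>U\<close> in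
  \<open>0\<close> or \<open>u i\<close> points.\<close>

definition uniform :: "(nat \<Rightarrow> nat) \<Rightarrow> 'a set \<Rightarrow> bool" where
  "uniform u U \<longleftrightarrow> U \<subseteq> P \<and> U \<noteq> {} \<and> (\<forall>i\<le>s. \<forall>x\<in>U. card (U \<inter> cell i x) = u i)"

lemma uniform_card: "uniform u U \<Longrightarrow> card U = u s"
  unfolding uniform_def using cell_top
  by (metis Int_absorb2 all_not_in_conv order_refl subsetD)

lemma uniform_pos:
  assumes "uniform u U" "i \<le> s"
  shows "u i > 0"
proof -
  obtain x where x: "x \<in> U" "x \<in> P" using assms(1) unfolding uniform_def by auto
  then have "x \<in> U \<inter> cell i x" using cell_in_level assms by auto
  moreover have "finite (U \<inter> cell i x)" using finite_cell assms by auto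
  ultimately have "card (U \<inter> cell i x) > 0" using card_gt_0_iff by blast
  then show ?thesis using assms x unfolding uniform_def by auto
qed

text \<open>Inside a level \<open>Suc m\<close> cell, \<open>U\<close> splits into its traces on
  level \<open>m\<close> cells, each of size \<open>u m\<close>. Hence the number of traces depends
  on \<open>u\<close> alone, which allows two uniform sets to be matched.\<close>

lemma uniform_step:
  assumes "uniform u U" "Suc m \<le> s" "x \<in> U"
  shows "u (Suc m) = u m * card (cell m ` (U \<inter> cell (Suc m) x))"
proof -
  let ?V = "U \<inter> cell (Suc m) x"
  have UP: "U \<subseteq> P" using assms unfolding uniform_def by auto
  have V: "?V = (\<Union>D\<in>cell m ` ?V. U \<inter> D)"
  proof (intro equalityI subsetI)
    fix w assume "w \<in> ?V"
    then show "w \<in> (\<Union>D\<in>cell m ` ?V. U \<inter> D)"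
      using cell_in_level(2)[of m w] UP assms by auto
  next
    fix w assume "w \<in> (\<Union>D\<in>cell m ` ?V. U \<inter> D)"
    then obtain t where t: "t \<in> ?V" "w \<in> U" "w \<in> cell m t" by auto
    then have "w \<in> cell (Suc m) t" using cell_Suc_mono[of m t] UP assms by auto
    then show "w \<in> ?V"
      using t mem_cell_iff[of "Suc m"] UP assms by (metis Int_iff subsetD)
  qed
  have fin: "finite ?V" using finite_cell assms by auto
  have "card ?V = (\<Sum>D\<in>cell m ` ?V. card (U \<inter> D))"
  proof (subst V, rule card_UN_disjoint)
    show "\<forall>D\<in>cell m ` ?V. finite (U \<inter> D)"
      using finite_cell[of m] assms by auto
    show "\<forall>D\<in>cell m ` ?V. \<forall>E\<in>cell m ` ?V. D \<noteq> E \<longrightarrow> (U \<inter> D) \<inter> (U \<inter> E) = {}"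
    proof -
      have "cell m w = D" if "D \<in> cell m ` ?V" "w \<in> U \<inter> D" for D w
        using that mem_cell_iff[of m _ w] UP assms by auto
      then show ?thesis by blast
    qed
  qed (use fin in auto)
  also have "\<dots> = (\<Sum>D\<in>cell m ` ?V. u m)"
    by (rule sum.cong) (use assms in \<open>auto simp: uniform_def\<close>)
  finally show ?thesis using assms by (simp add: uniform_def)
qed

lemma uniform_dvd: "uniform u U \<Longrightarrow> Suc m \<le> s \<Longrightarrow> u m dvd u (Suc m)"
  using uniform_step unfolding uniform_def by (metis dvd_triv_left equals0I)

lemma card_children:
  assumes "Suc m \<le> s" "X \<in> C (Suc m)"
  shows "card {Y \<in> C m. Y \<subseteq> X} = e (Suc m)"
  using chain assms unfolding partition_chain_def by (auto dest!: bspec[of _ _ "Suc m"])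

lemma children_eq:
  assumes "Suc m \<le> s" "x \<in> P"
  shows "{Y \<in> C m. Y \<subseteq> cell (Suc m) x} = cell m ` cell (Suc m) x"
proof (intro equalityI subsetI)
  fix Y assume Y: "Y \<in> {Y \<in> C m. Y \<subseteq> cell (Suc m) x}"
  then obtain t where "t \<in> Y" "Y = cell m t" using level_cellE[of m Y] assms by auto
  then show "Y \<in> cell m ` cell (Suc m) x" using Y by auto
next
  fix Y assume "Y \<in> cell m ` cell (Suc m) x"
  then obtain t where t: "t \<in> cell (Suc m) x" "Y = cell m t" by auto
  then have "t \<in> P" using cell_subset assms by blast
  then show "Y \<in> {Y \<in> C m. Y \<subseteq> cell (Suc m) x}"
    using t cell_in_level(1)[of m t] cell_Suc_mono[of m t] mem_cell_iff[of "Suc m" x t] assms by auto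
qed

lemma card_cell:
  assumes "i \<le> s" "x \<in> P"
  shows "card (cell i x) = (\<Prod>j=1..i. e j)"
  using assms
proof (induction i arbitrary: x)
  case 0
  then show ?case by (simp add: cell_0)
next
  case (Suc m)
  let ?S = "{Y \<in> C m. Y \<subseteq> cell (Suc m) x}"
  have "cell (Suc m) x = \<Union>?S"
  proof
    show "cell (Suc m) x \<subseteq> \<Union>?S"
      unfolding children_eq[OF Suc.prems]
      using cell_in_level(2)[of m] cell_subset[of "Suc m" x] Suc.prems by fastforce
  qed auto
  moreover have "card (\<Union>?S) = (\<Sum>Y\<in>?S. card Y)"
  proof (rule card_Union_disjoint)
    show "pairwise disjnt ?S"
      using partition_onD2[OF partition_on_level[of m]] Suc.prems
      by (auto simp: disjoint_def pairwise_def disjnt_def)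
    show "finite A" if "A \<in> ?S" for A
      using level_subset[of m A] that finite_P Suc.prems finite_subset by auto
  qed
  moreover have "(\<Sum>Y\<in>?S. card Y) = (\<Sum>Y\<in>?S. \<Prod>j=1..m. e j)"
  proof (rule sum.cong)
    fix Y assume "Y \<in> ?S"
    then obtain t where "t \<in> P" "Y = cell m t" using level_cellE[of m Y] Suc.prems by auto
    then show "card Y = (\<Prod>j=1..m. e j)" using Suc by auto
  qed simp
  moreover have "card ?S = e (Suc m)"
    using card_children Suc.prems cell_in_level(1) by blast
  ultimately show ?case by simp
qed

lemma uniform_P: "P \<noteq> {} \<Longrightarrow> uniform (\<lambda>i. \<Prod>j=1..i. e j) P"
  unfolding uniform_def using card_cell cell_subset by (auto simp: Int_absorb1)

section \<open>Extending level-preserving maps\<close>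

text \<open>If the distance of two points is the least level at which they share a class (an
  ultrametric), this says that \<open>f\<close> is an isometry on \<open>A\<close>. Level
  \<open>0\<close> makes \<open>f\<close> injective.\<close>

definition isom :: "'a set \<Rightarrow> ('a \<Rightarrow> 'a) \<Rightarrow> bool" where
  "isom A f \<longleftrightarrow> A \<subseteq> P \<and> f ` A \<subseteq> P \<and>
     (\<forall>i\<le>s. \<forall>x\<in>A. \<forall>z\<in>A. cell i (f z) = cell i (f x) \<longleftrightarrow> cell i z = cell i x)"

lemma isom_inj: "isom A f \<Longrightarrow> inj_on f A"
  unfolding isom_def inj_on_def using cell_0
  by (metis le0 singleton_inject subsetD)

text \<open>
  The point \<open>z\<close> first joins a point \<open>a\<close> of \<open>A\<close> at some level \<open>Suc m\<close>. Its image may be any point of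
  \<open>V\<close> in the level \<open>Suc m\<close> cell of \<open>f a\<close> whose level \<open>m\<close> cell is not yet met by \<open>f ` A\<close>; one exists
  because \<open>U\<close> and \<open>V\<close> meet equally many level \<open>m\<close> cells there.
\<close>
lemma isom_extend_point:
  assumes f: "isom A f" "A \<subseteq> U" "f ` A \<subseteq> V" "A \<noteq> {}"
    and U: "uniform u U" and V: "uniform u V" and z: "z \<in> U" "z \<notin> A"
  shows "\<exists>w\<in>V. isom (insert z A) (f(z := w))"
proof -
  have UP: "U \<subseteq> P" and VP: "V \<subseteq> P" using U V unfolding uniform_def by auto
  have AP: "A \<subseteq> P" and zP: "z \<in> P" using f z UP by auto
  have fA: "cell i (f b) = cell i (f a) \<longleftrightarrow> cell i b = cell i a"
    if "i \<le> s" "a \<in> A" "b \<in> A" for i a b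
    using f that unfolding isom_def by auto
  define i where "i = (LEAST i. \<exists>a\<in>A. cell i a = cell i z)"
  have ex: "\<exists>a\<in>A. cell s a = cell s z" using cell_top AP zP f(4) by blast
  then have "i \<le> s" unfolding i_def by (rule Least_le)
  have "\<exists>a\<in>A. cell i a = cell i z" unfolding i_def using ex by (rule LeastI)
  then obtain a where a: "a \<in> A" "cell i a = cell i z" by auto
  have least: "cell j b \<noteq> cell j z" if "j < i" "b \<in> A" for j b
    using not_less_Least[of j "\<lambda>i. \<exists>a\<in>A. cell i a = cell i z"] that unfolding i_def by auto
  have "i \<noteq> 0"
    using a z cell_0 AP zP by (metis singleton_inject subsetD)
  then obtain m where m: "i = Suc m" by (cases i) auto
  have ms: "Suc m \<le> s" "m \<le> s" using \<open>i \<le> s\<close> m by auto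
  have aP: "a \<in> P" and faV: "f a \<in> V" and faP: "f a \<in> P" using a AP f VP by auto
  let ?A = "{b \<in> A. cell i b = cell i a}"
  \<comment> \<open>The inclusion is strict because of \<open>cell m z\<close>, which contains no
    point of \<open>A\<close> by minimality of \<open>i\<close>.\<close>
  have "cell m ` ?A \<subset> cell m ` (U \<inter> cell i a)"
  proof (rule psubsetI)
    have "?A \<subseteq> U \<inter> cell i a"
      using f AP aP \<open>i \<le> s\<close> mem_cell_iff[of i a] by auto
    then show "cell m ` ?A \<subseteq> cell m ` (U \<inter> cell i a)" by (rule image_mono)
    have "z \<in> U \<inter> cell i a" using z a mem_cell_iff[of i a z] \<open>i \<le> s\<close> aP zP by auto
    moreover have "cell m z \<notin> cell m ` ?A" using least[of m] m by force
    ultimately show "cell m ` ?A \<noteq> cell m ` (U \<inter> cell i a)" by blast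
  qed
  moreover have "finite (cell m ` (U \<inter> cell i a))" using finite_cell \<open>i \<le> s\<close> by auto
  ultimately have "card (cell m ` ?A) < card (cell m ` (U \<inter> cell i a))"
    by (rule psubset_card_mono[rotated])
  also have "\<dots> = card (cell m ` (V \<inter> cell i (f a)))"
  proof -
    \<comment> \<open>Both products equal \<open>u (Suc m)\<close>, computed in \<open>U\<close> at
      \<open>a\<close> and in \<open>V\<close> at \<open>f a\<close>.\<close>
    have "u m * card (cell m ` (U \<inter> cell i a)) = u m * card (cell m ` (V \<inter> cell i (f a)))"
      using uniform_step[OF U ms(1), of a] uniform_step[OF V ms(1) faV] a f m by auto
    then show ?thesis using uniform_pos[OF U ms(2)] by simp
  qed
  also have "card (cell m ` ?A) = card ((\<lambda>b. cell m (f b)) ` ?A)"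
    by (rule card_image_same_kernel) (use fA[OF ms(2)] in auto)
  finally have "card ((\<lambda>b. cell m (f b)) ` ?A) < card (cell m ` (V \<inter> cell i (f a)))" .
  moreover have "finite ((\<lambda>b. cell m (f b)) ` ?A)"
    using finite_subset[OF AP finite_P] by simp
  ultimately have "\<not> cell m ` (V \<inter> cell i (f a)) \<subseteq> (\<lambda>b. cell m (f b)) ` ?A"
    by (metis card_mono not_less)
  then obtain w where w: "w \<in> V" "w \<in> cell i (f a)" "cell m w \<notin> (\<lambda>b. cell m (f b)) ` ?A"
    by blast
  have wP: "w \<in> P" using w VP by auto
  have coarsen: "cell j x = cell j x'" if "cell i' x = cell i' x'" "i' \<le> j" "j \<le> s" "x \<in> P" "x' \<in> P"
    for i' j x x'
  proof -
    have "i' \<le> s" using that by linarith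
    then have "x \<in> cell i' x'" using mem_cell_iff[of i' x' x] that by simp
    then have "x \<in> cell j x'" using cell_mono[of i' j x'] that by blast
    then show ?thesis using mem_cell_iff[of j x' x] that by simp
  qed
  have wfa: "cell i w = cell i (f a)"
    using w mem_cell_iff[of i "f a" w] \<open>i \<le> s\<close> faP wP by auto
  \<comment> \<open>The choice of \<open>w\<close> avoids only the images of \<open>?A\<close>. Any
    other \<open>b\<close> is excluded too: sharing a level \<open>m\<close> cell with
    \<open>w\<close> would put \<open>f b\<close> into the level \<open>i\<close> cell of
    \<open>f a\<close>, hence \<open>b\<close> into \<open>?A\<close>.\<close>
  have wm: "cell m w \<noteq> cell m (f b)" if "b \<in> A" for b
  proof
    assume eq: "cell m w = cell m (f b)"
    have "f b \<in> P" using that f VP by auto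
    then have "cell i w = cell i (f b)"
      using coarsen[OF eq] ms m wP by auto
    then have "b \<in> ?A" using wfa fA[OF \<open>i \<le> s\<close> a(1) that] that by auto
    then show False using w(3) eq by auto
  qed
  \<comment> \<open>Below level \<open>i\<close> both sides are false; from level \<open>i\<close>
    on, \<open>w\<close> and \<open>z\<close> have the same cells as \<open>f a\<close> and
    \<open>a\<close>.\<close>
  have key: "cell j (f b) = cell j w \<longleftrightarrow> cell j b = cell j z" if "j \<le> s" "b \<in> A" for j b
  proof (cases "j < i")
    case True
    have "f b \<in> P" using that f VP by auto
    then have "cell j (f b) \<noteq> cell j w"
      using wm[OF that(2)] coarsen[of j "f b" w m] True m ms wP by auto
    then show ?thesis using least[OF True that(2)] by simp
  next
    case False
    then have "cell j w = cell j (f a)" "cell j z = cell j a"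
      using coarsen[OF wfa] coarsen[OF a(2)[symmetric]] that wP faP aP zP by auto
    then show ?thesis using fA[OF that(1) a(1) that(2)] by simp
  qed
  have "isom (insert z A) (f(z := w))"
    unfolding isom_def
  proof (intro conjI allI impI ballI)
    show "f(z := w) ` insert z A \<subseteq> P" using z(2) f VP wP by auto
    show "insert z A \<subseteq> P" using AP zP by auto
    fix j x x' assume "j \<le> s" "x \<in> insert z A" "x' \<in> insert z A"
    then show "(cell j ((f(z := w)) x') = cell j ((f(z := w)) x)) = (cell j x' = cell j x)"
      using key[of j] fA[of j] z(2) by (cases "x = z"; cases "x' = z") (auto; metis)+
  qed
  then show ?thesis using w by auto
qed

text \<open>The points of \<open>U\<close> are added one at a time. The resulting map into
  \<open>V\<close> is injective, and \<open>U\<close> and \<open>V\<close> both have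
  \<open>u s\<close> elements, so it is onto.\<close>

lemma isom_extend:
  assumes f: "isom A f" "A \<subseteq> U" "f ` A \<subseteq> V" "A \<noteq> {}"
    and U: "uniform u U" and V: "uniform u V"
  obtains g where "isom U g" "g ` U = V" "\<And>a. a \<in> A \<Longrightarrow> g a = f a"
proof -
  have fin: "finite U" "finite V"
    using U V finite_P finite_subset unfolding uniform_def by blast+
  have "\<exists>g. isom (A \<union> D) g \<and> g ` (A \<union> D) \<subseteq> V \<and> (\<forall>a\<in>A. g a = f a)"
    if "finite D" "D \<subseteq> U" for D
    using that
  proof (induction D rule: finite_induct)
    case empty
    then show ?case using f by auto
  next
    case (insert z D)
    then obtain g where g: "isom (A \<union> D) g" "g ` (A \<union> D) \<subseteq> V" "\<forall>a\<in>A. g a = f a" by auto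
    show ?case
    proof (cases "z \<in> A")
      case True
      then show ?thesis using g by (auto simp: insert_absorb)
    next
      case False
      then obtain w where "w \<in> V" and "isom (insert z (A \<union> D)) (g(z := w))"
        using isom_extend_point[OF g(1) _ g(2) _ U V, of z] f insert by auto
      moreover have "A \<union> insert z D = insert z (A \<union> D)" by auto
      moreover have "g(z := w) ` insert z (A \<union> D) \<subseteq> V" using g(2) \<open>w \<in> V\<close> by auto
      ultimately show ?thesis
        using g(3) False by (intro exI[of _ "g(z := w)"]) (simp del: fun_upd_apply, auto)
    qed
  qed
  from this[OF fin(1) order_refl] obtain g
    where g: "isom U g" "g ` U \<subseteq> V" "\<forall>a\<in>A. g a = f a"
    using f(2) by (auto simp: Un_absorb1)
  have "card (g ` U) = card V"
    using card_image[OF isom_inj[OF g(1)]] uniform_card U V by metis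
  then have "g ` U = V" using card_subset_eq[OF fin(2) g(2)] by simp
  then show ?thesis using that g by auto
qed

text \<open>\<open>isom\<close> alone yields the inclusion of the image in the cell; equality uses
  that \<open>g\<close> is onto \<open>P\<close>.\<close>

lemma isom_image_cell:
  assumes g: "isom P g" "g ` P = P" and "i \<le> s" "x \<in> P"
  shows "g ` cell i x = cell i (g x)"
proof
  have gP: "g t \<in> P" if "t \<in> P" for t using g that by auto
  have eq: "g t \<in> cell i (g x) \<longleftrightarrow> t \<in> cell i x" if "t \<in> P" for t
    using g(1) that assms(3,4) gP mem_cell_iff unfolding isom_def by auto
  show "g ` cell i x \<subseteq> cell i (g x)"
    using eq cell_subset[OF assms(3)] by blast
  show "cell i (g x) \<subseteq> g ` cell i x"
  proof
    fix w assume w: "w \<in> cell i (g x)"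
    then have "w \<in> P" using cell_subset[OF assms(3)] by blast
    then obtain t where "t \<in> P" "w = g t" using g(2) by auto
    then show "w \<in> g ` cell i x" using eq w by auto
  qed
qed

lemma isom_image_uniform:
  assumes g: "isom P g" "g ` P = P" and B: "uniform u B"
  shows "uniform u (g ` B)"
  unfolding uniform_def
proof (intro conjI allI impI ballI)
  have BP: "B \<subseteq> P" "B \<noteq> {}" using B unfolding uniform_def by auto
  then show "g ` B \<subseteq> P" "g ` B \<noteq> {}" using g by auto
  fix i y assume i: "i \<le> s" and "y \<in> g ` B"
  then obtain x where x: "x \<in> B" "y = g x" by auto
  have inj: "inj_on g P" using isom_inj g by auto
  have "g ` B \<inter> cell i y = g ` (B \<inter> cell i x)"
    using inj_on_image_Int[OF inj BP(1) cell_subset[OF i, of x]] isom_image_cell[OF g i, of x] x BP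
    by auto
  moreover have "inj_on g (B \<inter> cell i x)" using inj BP by (meson inf_le1 inj_on_subset)
  ultimately show "card (g ` B \<inter> cell i y) = u i"
    using B i x by (simp add: card_image uniform_def)
qed

section \<open>Construction of a uniform set\<close>

text \<open>Built from the bottom up: in a class of level \<open>Suc i\<close>, choose
  \<open>Y (Suc i) / Y i\<close> of its \<open>e (Suc i)\<close> subclasses and take the union of
  sets already built inside them. Assumption \<open>le\<close> ensures that there are enough
  subclasses.\<close>

lemma uniform_exists:
  assumes Y0: "Y 0 = 1" and pos: "\<And>i. i \<le> s \<Longrightarrow> Y i > 0"
    and dvd: "\<And>i. i < s \<Longrightarrow> Y i dvd Y (Suc i)"
    and le: "\<And>i. i < s \<Longrightarrow> Y (Suc i) \<le> e (Suc i) * Y i"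
    and "P \<noteq> {}"
  obtains B where "uniform Y B"
proof -
  have ex: "\<exists>B\<subseteq>cell i x. B \<noteq> {} \<and> (\<forall>j\<le>i. \<forall>w\<in>B. card (B \<inter> cell j w) = Y j)"
    if "i \<le> s" "x \<in> P" for i x
    using that
  proof (induction i arbitrary: x)
    case 0
    then show ?case by (intro exI[of _ "{x}"]) (auto simp: cell_0 Y0)
  next
    case (Suc i)
    let ?S = "{Z \<in> C i. Z \<subseteq> cell (Suc i) x}"
    obtain q where q: "Y (Suc i) = Y i * q" using dvd[of i] Suc.prems by (auto elim: dvdE)
    have "q > 0" using q pos[of "Suc i"] Suc.prems by (cases q) auto
    have "q \<le> card ?S"
      using le[of i] q pos[of i] card_children[of i "cell (Suc i) x"] cell_in_level(1) Suc.prems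
      by (simp add: mult.commute)
    then obtain T where T: "T \<subseteq> ?S" "card T = q" "finite T"
      by (rule obtain_subset_with_card_n)
    have "\<exists>B\<subseteq>Z. B \<noteq> {} \<and> (\<forall>j\<le>i. \<forall>w\<in>B. card (B \<inter> cell j w) = Y j)" if Z: "Z \<in> T" for Z
    proof -
      obtain t where "t \<in> P" "Z = cell i t"
        using level_cellE[of i Z] Z T Suc.prems by auto
      then show ?thesis using Suc by auto
    qed
    then obtain D where D: "\<And>Z. Z \<in> T \<Longrightarrow> D Z \<subseteq> Z" "\<And>Z. Z \<in> T \<Longrightarrow> D Z \<noteq> {}"
      "\<And>Z j w. Z \<in> T \<Longrightarrow> j \<le> i \<Longrightarrow> w \<in> D Z \<Longrightarrow> card (D Z \<inter> cell j w) = Y j"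
      by metis
    let ?B = "\<Union>(D ` T)"
    have T_cell: "cell i w = Z" if "Z \<in> T" "w \<in> Z" for Z w
      using cell_eq[of i Z w] that T Suc.prems by auto
    have T_P: "w \<in> P" if "Z \<in> T" "w \<in> Z" for Z w
      using cell_subset[of "Suc i" x] that T Suc.prems by auto
    \<comment> \<open>A cell of level at most \<open>i\<close> lies within one chosen subclass, so
      the pieces in the other subclasses do not contribute.\<close>
    have low: "card (?B \<inter> cell j w) = Y j" if "j \<le> i" "w \<in> D Z" "Z \<in> T" for j w Z
    proof -
      have "w \<in> Z" "w \<in> P" using that D T_P by blast+
      have "cell j w \<subseteq> Z"
        using cell_mono[of j i w] T_cell[OF that(3) \<open>w \<in> Z\<close>] that \<open>w \<in> P\<close> Suc.prems by auto
      then have "?B \<inter> cell j w = D Z \<inter> cell j w"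
        using T_cell D(1) that(3) by blast
      then show ?thesis using D(3) that by simp
    qed
    have card_D: "card (D Z) = Y i" if "Z \<in> T" for Z
    proof -
      obtain w where "w \<in> D Z" using D(2) \<open>Z \<in> T\<close> by auto
      then show ?thesis
        using D(3)[OF that order_refl, of w] D(1)[OF that] T_cell[OF that, of w]
        by (metis Int_absorb2 subsetD)
    qed
    have "card ?B = (\<Sum>Z\<in>T. card (D Z))"
    proof (rule card_UN_disjoint)
      show "\<forall>Z\<in>T. finite (D Z)"
        using D(1) T_P finite_P by (meson finite_subset subsetI subsetD)
      show "\<forall>Z\<in>T. \<forall>Z'\<in>T. Z \<noteq> Z' \<longrightarrow> D Z \<inter> D Z' = {}"
        using D(1) T_cell by blast
    qed (use T in auto)
    then have cB: "card ?B = Y (Suc i)" using card_D T q by simp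
    have B: "?B \<subseteq> cell (Suc i) x" using D(1) T by blast
    have top: "card (?B \<inter> cell (Suc i) w) = Y (Suc i)" if "w \<in> ?B" for w
    proof -
      have "w \<in> cell (Suc i) x" using B that by auto
      then have "cell (Suc i) w = cell (Suc i) x"
        using mem_cell_iff[of "Suc i" x w] cell_subset[of "Suc i" x] Suc.prems by auto
      then show ?thesis using cB B by (simp add: Int_absorb2)
    qed
    have "?B \<noteq> {}" using T(2) \<open>q > 0\<close> D(2) by fastforce
    moreover have "card (?B \<inter> cell j w) = Y j" if "j \<le> Suc i" "w \<in> ?B" for j w
      using that low top[of w] by (cases "j = Suc i") auto
    ultimately show ?case using B by blast
  qed
  obtain x where "x \<in> P" using \<open>P \<noteq> {}\<close> by auto
  then obtain B where "B \<subseteq> cell s x" "B \<noteq> {}"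
      "\<forall>j\<le>s. \<forall>w\<in>B. card (B \<inter> cell j w) = Y j"
    using ex[OF order_refl \<open>x \<in> P\<close>] by metis
  then have "uniform Y B"
    using cell_subset[of s x] unfolding uniform_def by auto
  then show ?thesis by (rule that)
qed

section \<open>The design of all uniform sets\<close>

text \<open>This is the iterated wreath product of the symmetric groups of degrees
  \<open>e 1\<close>, ..., \<open>e s\<close>. Membership in \<open>Bij P\<close> fixes the values
  outside \<open>P\<close>, as \<open>BijGroup\<close> requires.\<close>

definition tower_group :: "('a \<Rightarrow> 'a) set" where
  "tower_group = {g \<in> Bij P. isom P g}"

lemma tower_groupD:
  assumes "g \<in> tower_group"
  shows "isom P g" "g ` P = P" "inj_on g P"
  using assms unfolding tower_group_def Bij_def bij_betw_def by auto

text \<open>Two extensions in succession: from \<open>A\<close> to a map of \<open>U\<close> onto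
  \<open>V\<close>, then from \<open>U\<close> to all of \<open>P\<close>, which is itself
  uniform.\<close>

lemma tower_group_homogeneous:
  assumes f: "isom A f" "A \<subseteq> U" "f ` A \<subseteq> V" "A \<noteq> {}"
    and U: "uniform u U" and V: "uniform u V"
  obtains g where "g \<in> tower_group" "g ` U = V" "\<And>a. a \<in> A \<Longrightarrow> g a = f a"
proof -
  have UP: "U \<subseteq> P" "U \<noteq> {}" "V \<subseteq> P" using U V unfolding uniform_def by auto
  then have uP: "uniform (\<lambda>i. \<Prod>j=1..i. e j) P" using uniform_P by auto
  obtain h where h: "isom U h" "h ` U = V" "\<And>a. a \<in> A \<Longrightarrow> h a = f a"
    using isom_extend[OF f U V] by blast
  obtain g where g: "isom P g" "g ` P = P" "\<And>a. a \<in> U \<Longrightarrow> g a = h a"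
    using isom_extend[OF h(1) UP(1) _ UP(2) uP uP] h(2) UP(3) by auto
  have "isom P (restrict g P)" using g(1) unfolding isom_def by auto
  moreover have "restrict g P \<in> Bij P"
    using g(2) isom_inj[OF g(1)] unfolding Bij_def bij_betw_def by (auto simp: inj_on_def)
  moreover have "restrict g P ` U = V"
    using h(2) g(3) UP(1) by (force simp: subset_iff)
  moreover have "restrict g P a = f a" if "a \<in> A" for a
    using that f(2) UP(1) g(3) h(3) by auto
  ultimately show ?thesis using that unfolding tower_group_def by auto
qed

lemma tower_group_inverse:
  assumes "g \<in> tower_group"
  shows "(\<lambda>x\<in>P. inv_into P g x) \<in> tower_group"
proof -
  note g = tower_groupD[OF assms]
  have h: "inv_into P g x \<in> P" "g (inv_into P g x) = x" if "x \<in> P" for x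
    using g(2) that by (auto simp: inv_into_into f_inv_into_f)
  have "cell i (inv_into P g z) = cell i (inv_into P g x) \<longleftrightarrow> cell i z = cell i x"
    if "i \<le> s" "x \<in> P" "z \<in> P" for i x z
    using g(1) h that unfolding isom_def by metis
  then have "isom P (\<lambda>x\<in>P. inv_into P g x)"
    using h unfolding isom_def by auto
  then show ?thesis
    using assms restrict_inv_into_Bij unfolding tower_group_def by auto
qed

lemma subgroup_tower_group:
  assumes "\<forall>B\<in>\<B>. B \<subseteq> P" and im: "\<And>g. g \<in> tower_group \<Longrightarrow> (`) g ` \<B> = \<B>"
  shows "subgroup tower_group (design_Aut P \<B>)"
proof -
  interpret group "design_Aut P \<B>" using group_design_Aut assms(1) by blast
  have sub: "tower_group \<subseteq> carrier (design_Aut P \<B>)"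
    using im unfolding design_Aut_def tower_group_def by auto
  have one: "\<one>\<^bsub>design_Aut P \<B>\<^esub> = (\<lambda>x\<in>P. x)"
    and mult: "g \<otimes>\<^bsub>design_Aut P \<B>\<^esub> h = compose P g h" if "g \<in> Bij P" "h \<in> Bij P" for g h
    using that unfolding design_Aut_def BijGroup_def by auto
  show ?thesis
  proof (rule subgroupI[OF sub])
    have "(\<lambda>x\<in>P. x) \<in> tower_group"
      using id_Bij unfolding tower_group_def isom_def by auto
    then show "tower_group \<noteq> {}" by auto
  next
    fix g assume g: "g \<in> tower_group"
    let ?h = "\<lambda>x\<in>P. inv_into P g x"
    have h: "?h \<in> tower_group" using tower_group_inverse[OF g] .
    have B: "g \<in> Bij P" "?h \<in> Bij P" using g h unfolding tower_group_def by auto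
    have "?h \<otimes>\<^bsub>design_Aut P \<B>\<^esub> g = \<one>\<^bsub>design_Aut P \<B>\<^esub>"
      using one[OF B] mult[OF B(2,1)] Bij_compose_restrict_eq[OF B(1)] by simp
    then have "inv\<^bsub>design_Aut P \<B>\<^esub> g = ?h"
      using inv_equality g h sub by blast
    then show "inv\<^bsub>design_Aut P \<B>\<^esub> g \<in> tower_group" using h by simp
  next
    fix g h assume g: "g \<in> tower_group" and h: "h \<in> tower_group"
    then have B: "g \<in> Bij P" "h \<in> Bij P" unfolding tower_group_def by auto
    have "h x \<in> P" "g x \<in> P" if "x \<in> P" for x using that tower_groupD g h by blast+
    then have "isom P (compose P g h)"
      using tower_groupD(1)[OF g] tower_groupD(1)[OF h] unfolding isom_def
      by (auto simp: compose_def)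
    then show "g \<otimes>\<^bsub>design_Aut P \<B>\<^esub> h \<in> tower_group"
      using mult[OF B] compose_Bij[OF B] unfolding tower_group_def by simp
  qed
qed

text \<open>The family is finite and taking images under \<open>g\<close> is injective on it, so
  mapping the family into itself suffices.\<close>

lemma bij_betw_image_family:
  assumes g: "g \<in> tower_group" and "\<A> \<subseteq> Pow P" and "\<And>X. X \<in> \<A> \<Longrightarrow> g ` X \<in> \<A>"
  shows "bij_betw ((`) g) \<A> \<A>"
proof -
  have "inj_on ((`) g) \<A>"
    using inj_on_image_Pow[OF tower_groupD(3)[OF g]] assms(2) by (rule inj_on_subset)
  moreover have "finite \<A>" using assms(2) finite_P finite_subset by blast
  ultimately show ?thesis
    using assms(3) endo_inj_surj unfolding bij_betw_def by (metis image_subsetI)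
qed

lemma preserves_partition_tower_group:
  assumes "i \<le> s"
  shows "preserves_partition tower_group (C i)"
  unfolding preserves_partition_def
proof
  fix g assume g: "g \<in> tower_group"
  have "g ` X \<in> C i" if X: "X \<in> C i" for X
  proof -
    obtain x where x: "x \<in> P" "X = cell i x" by (rule level_cellE[OF assms X])
    then have "g x \<in> P" using tower_groupD[OF g] by auto
    then show ?thesis
      using isom_image_cell[OF tower_groupD(1,2)[OF g] assms x(1)] x(2) cell_in_level(1)[OF assms]
      by simp
  qed
  then show "bij_betw ((`) g) (C i) (C i)"
    using bij_betw_image_family[OF g] level_subset[OF assms] by blast
qed

text \<open>The least level joining the two points is positive, as level \<open>0\<close> classes
  are singletons; \<open>m\<close> is the last level separating them.\<close>

lemma separation_level:
  assumes "x \<in> P" "z \<in> P" "x \<noteq> z"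
  obtains m where "Suc m \<le> s" "\<And>i. i \<le> s \<Longrightarrow> cell i z = cell i x \<longleftrightarrow> Suc m \<le> i"
proof -
  define n where "n = (LEAST i. cell i z = cell i x)"
  have top: "cell s z = cell s x" using cell_top assms by auto
  then have ns: "n \<le> s" unfolding n_def by (rule Least_le)
  have n: "cell n z = cell n x" unfolding n_def using top by (rule LeastI)
  have "cell 0 z \<noteq> cell 0 x" using cell_0 assms by auto
  then obtain m where m: "n = Suc m" using n by (cases n) auto
  have "cell i z = cell i x \<longleftrightarrow> Suc m \<le> i" if "i \<le> s" for i
  proof
    assume "cell i z = cell i x"
    then show "Suc m \<le> i" using Least_le[of "\<lambda>i. cell i z = cell i x" i] m n_def by simp
  next
    assume "Suc m \<le> i"
    then have "cell n x \<subseteq> cell i x" using cell_mono[of n i x] m that assms by auto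
    then show "cell i z = cell i x" 
      using mem_cell_iff[of n x z] mem_cell_iff[of i x z] ns that n assms by blast
  qed
  then show ?thesis using that m ns by auto
qed

text \<open>Flag-transitivity is homogeneity for one-point maps. For pairs, \<open>eq\<close> makes
  the ratio of \<open>Y (Suc m) - Y m\<close> to the corresponding difference of class sizes equal
  to \<open>(k - 1) / (v - 1)\<close> at every level, so the pair count is independent of the
  level.\<close>

lemma uniform_sets_design:
  assumes B0: "uniform Y B0" and card_P: "card P = v" and v: "v > 1" and Ys: "Y s = k"
    and eq: "\<And>i. i \<le> s \<Longrightarrow> (v - 1) * Y i + (k - 1) = (v - 1) + (k - 1) * (\<Prod>j=1..i. e j)"
  defines "\<B> \<equiv> {B. uniform Y B}"
  shows "\<exists>lam. two_design P \<B> v k lam" "subgroup tower_group (design_Aut P \<B>)"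
    "flag_transitive tower_group P \<B>"
proof -
  let ?c = "\<lambda>i. \<Prod>j=1..i. e j"
  have BP: "\<B> \<subseteq> Pow P" unfolding \<B>_def uniform_def by auto
  then have finB: "finite \<B>" using finite_P finite_subset by blast
  have bij: "bij_betw ((`) g) \<B> \<B>" if "g \<in> tower_group" for g
    using bij_betw_image_family[OF that BP] isom_image_uniform tower_groupD[OF that]
    unfolding \<B>_def by auto
  show "subgroup tower_group (design_Aut P \<B>)"
    using subgroup_tower_group[of \<B>] BP bij unfolding bij_betw_def by blast
  show "flag_transitive tower_group P \<B>"
    unfolding flag_transitive_def flags_def
  proof clarify
    fix x B x' B' assume *: "x \<in> P" "B \<in> \<B>" "x \<in> B" "x' \<in> P" "B' \<in> \<B>" "x' \<in> B'"
    have "isom {x} (\<lambda>_. x')" using * unfolding isom_def by auto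
    then obtain g where "g \<in> tower_group" "g ` B = B'" "g x = x'"
      using tower_group_homogeneous[of "{x}" "\<lambda>_. x'" B B' Y] * unfolding \<B>_def by auto
    then show "\<exists>g\<in>tower_group. g x = x' \<and> g ` B = B'" by auto
  qed
  define N where "N x z = card {B \<in> \<B>. x \<in> B \<and> z \<in> B}" for x z
  have N_inv: "N (g x) (g z) = N x z" if g: "g \<in> tower_group" and "x \<in> P" "z \<in> P" for g x z
  proof -
    have mem: "g t \<in> g ` B \<longleftrightarrow> t \<in> B" if "t \<in> P" "B \<in> \<B>" for t B
      using tower_groupD(3)[OF g] that BP by (meson PowD inj_on_image_mem_iff subsetD)
    have im: "(`) g ` \<B> = \<B>" and inj: "inj_on ((`) g) \<B>" using bij[OF g] unfolding bij_betw_def by auto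
    have "{B \<in> \<B>. g x \<in> B \<and> g z \<in> B} = (`) g ` {B \<in> \<B>. x \<in> B \<and> z \<in> B}"
    proof (intro equalityI subsetI)
      fix D assume D: "D \<in> {B \<in> \<B>. g x \<in> B \<and> g z \<in> B}"
      then have "D \<in> (`) g ` \<B>" using im by simp
      then obtain B where "B \<in> \<B>" "D = g ` B" by blast
      then show "D \<in> (`) g ` {B \<in> \<B>. x \<in> B \<and> z \<in> B}" using D mem that by auto
    next
      fix D assume "D \<in> (`) g ` {B \<in> \<B>. x \<in> B \<and> z \<in> B}"
      then show "D \<in> {B \<in> \<B>. g x \<in> B \<and> g z \<in> B}" using im by auto
    qed
    moreover have "inj_on ((`) g) {B \<in> \<B>. x \<in> B \<and> z \<in> B}" using inj by (rule inj_on_subset) auto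
    ultimately show ?thesis unfolding N_def by (simp add: card_image)
  qed
  have P0: "P \<noteq> {}" using card_P v by auto
  then obtain p where p: "p \<in> P" by auto
  note uP = uniform_P[OF P0]
  have N_diag: "N x x = N p p" if x: "x \<in> P" for x
  proof -
    have "isom {p} (\<lambda>_. x)" using x p unfolding isom_def by auto
    then obtain g where "g \<in> tower_group" "g p = x"
      using tower_group_homogeneous[of "{p}" "\<lambda>_. x", OF _ _ _ _ uP uP] x p by auto
    then show ?thesis using N_inv[of g p p] p by auto
  qed
  have N_eq: "(v - 1) * N x z = N p p * (k - 1)" if xz: "x \<in> P" "z \<in> P" "x \<noteq> z" for x z
  proof -
    obtain m where m: "Suc m \<le> s" "\<And>i. i \<le> s \<Longrightarrow> cell i z = cell i x \<longleftrightarrow> Suc m \<le> i"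
      using separation_level[OF xz] by metis
    \<comment> \<open>\<open>S\<close> consists of the points that first join \<open>x\<close> at
      level \<open>Suc m\<close>, the level at which \<open>z\<close> does.\<close>
    define S where "S = cell (Suc m) x - cell m x"
    have sub: "cell m x \<subseteq> cell (Suc m) x" using cell_Suc_mono m xz by auto
    have SP: "S \<subseteq> P" using cell_subset m S_def by blast
    then have finS: "finite S" using finite_P finite_subset by blast
    have zS: "z \<in> S" unfolding S_def using m mem_cell_iff xz by auto
    have "N x w = N x z" if w: "w \<in> S" for w
    proof -
      have wP: "w \<in> P" using w SP by auto
      have "cell i w = cell i x \<longleftrightarrow> Suc m \<le> i" if "i \<le> s" for i
        using w cell_mono[of "Suc m" i x] cell_mono[of i m x] mem_cell_iff[OF that xz(1) wP] that m(1) xz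
        unfolding S_def by (meson DiffD1 DiffD2 Suc_leD not_less_eq_eq subsetD)
      \<comment> \<open>The map fixing \<open>x\<close> and sending \<open>z\<close> to
        \<open>w\<close> preserves levels, since both points join \<open>x\<close> at the same
        level. It extends to an element of \<open>tower_group\<close>.\<close>
      then have "isom {x, z} (id(z := w))"
        using m(2) xz wP unfolding isom_def by auto
      then obtain g where "g \<in> tower_group" "\<And>a. a \<in> {x, z} \<Longrightarrow> g a = (id(z := w)) a"
        by (rule tower_group_homogeneous[OF _ _ _ _ uP uP, of "{x, z}" "id(z := w)"])
          (use wP xz in auto)
      then show ?thesis using N_inv[of g x z] xz by simp
    qed
    then have "card S * N x z = (\<Sum>w\<in>S. N x w)" by simp
    also have "\<dots> = (\<Sum>B\<in>{B \<in> \<B>. x \<in> B}. card (B \<inter> S))"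
      unfolding N_def by (rule sum_card_blocks[OF finB finS])
    also have "\<dots> = (\<Sum>B\<in>{B \<in> \<B>. x \<in> B}. Y (Suc m) - Y m)"
    proof (rule sum.cong)
      fix B assume B: "B \<in> {B \<in> \<B>. x \<in> B}"
      have "B \<inter> S = (B \<inter> cell (Suc m) x) - (B \<inter> cell m x)" unfolding S_def by auto
      moreover have "card \<dots> = card (B \<inter> cell (Suc m) x) - card (B \<inter> cell m x)"
        by (rule card_Diff_subset) (use sub finite_cell m in auto)
      ultimately show "card (B \<inter> S) = Y (Suc m) - Y m"
        using B m(1) unfolding \<B>_def uniform_def by simp
    qed simp
    also have "\<dots> = N p p * (Y (Suc m) - Y m)"
      using N_diag[OF xz(1)] unfolding N_def by simp
    finally have count: "card S * N x z = N p p * (Y (Suc m) - Y m)" .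
    have cS: "card S = ?c (Suc m) - ?c m"
      unfolding S_def using card_Diff_subset[OF _ sub] finite_cell m card_cell xz by auto
    \<comment> \<open>Subtracting \<open>eq\<close> at two consecutive levels removes the constants
      and brings in \<open>card S\<close>.\<close>
    have "(v - 1) * Y (Suc m) - (v - 1) * Y m = (k - 1) * ?c (Suc m) - (k - 1) * ?c m"
      using eq[of m] eq[of "Suc m"] m(1) by linarith
    then have "(v - 1) * (Y (Suc m) - Y m) = (k - 1) * card S"
      unfolding cS diff_mult_distrib2 .
    then have "card S * ((v - 1) * N x z) = card S * (N p p * (k - 1))"
      using count by (metis mult.assoc mult.commute)
    moreover have "card S > 0" using zS finS card_gt_0_iff by blast
    ultimately show ?thesis by simp
  qed
  \<comment> \<open>The division is exact by \<open>N_eq\<close>; \<open>N p p\<close> is the number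
    of blocks through a point.\<close>
  have "N x z = N p p * (k - 1) div (v - 1)" if "x \<in> P" "z \<in> P" "x \<noteq> z" for x z
    using N_eq[OF that] v by (metis nonzero_mult_div_cancel_left not_less_iff_gr_or_eq zero_less_diff)
  then have "two_design P \<B> v k (N p p * (k - 1) div (v - 1))"
    unfolding two_design_def
    using finite_P card_P B0 uniform_card Ys BP N_def unfolding \<B>_def by auto
  then show "\<exists>lam. two_design P \<B> v k lam" by blast
qed

section \<open>Blocks of flag-transitive designs\<close>

text \<open>A group element taking the flag \<open>(p, B0)\<close> to \<open>(x, B)\<close> maps
  \<open>B0 \<inter> cell i p\<close> onto \<open>B \<inter> cell i x\<close>. With \<open>r\<close>
  blocks through \<open>p\<close>, counting gives \<open>r * (Y i - 1) = lam * (?c i - 1)\<close>;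
  the case \<open>i = s\<close> then eliminates \<open>r\<close> and \<open>lam\<close>.\<close>

lemma flag_transitive_design_uniform:
  assumes D: "two_design P \<B> v k lam" and G: "subgroup G (design_Aut P \<B>)"
    and ft: "flag_transitive G P \<B>" and pres: "\<forall>i\<in>{0..s}. preserves_partition G (C i)"
    and k: "k \<ge> 2" and v: "v > 1"
  obtains Y where "\<And>B. B \<in> \<B> \<Longrightarrow> uniform Y B"
    "\<And>i. i \<le> s \<Longrightarrow> (v - 1) * Y i + (k - 1) = (v - 1) + (k - 1) * (\<Prod>j=1..i. e j)"
proof -
  let ?c = "\<lambda>i. \<Prod>j=1..i. e j"
  have BP: "\<And>B. B \<in> \<B> \<Longrightarrow> B \<subseteq> P" and Bk: "\<And>B. B \<in> \<B> \<Longrightarrow> card B = k"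
    and card_P: "card P = v"
    and lam: "\<And>x z. x \<in> P \<Longrightarrow> z \<in> P \<Longrightarrow> x \<noteq> z \<Longrightarrow> card {B \<in> \<B>. x \<in> B \<and> z \<in> B} = lam"
    using D unfolding two_design_def by auto
  obtain B0 where B0: "B0 \<in> \<B>" using D unfolding two_design_def by auto
  have finB: "finite \<B>" using BP finite_P by (meson PowI finite_Pow_iff finite_subset subsetI)
  obtain p where p: "p \<in> B0" using Bk[OF B0] k by fastforce
  then have pP: "p \<in> P" using BP B0 by auto
  have "B0 \<noteq> {p}" using Bk[OF B0] k by auto
  then obtain z where z: "z \<in> B0" "z \<noteq> p" using p by auto
  \<comment> \<open>Since \<open>k \<ge> 2\<close>, the block \<open>B0\<close> contains a second
    point. Positivity of \<open>lam\<close> yields \<open>r > 0\<close>, so \<open>r\<close> can be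
    cancelled below.\<close>
  have "lam > 0"
  proof -
    have "z \<in> P" using z BP[OF B0] by auto
    then have "card {B \<in> \<B>. p \<in> B \<and> z \<in> B} = lam" using lam[of p z] z pP by simp
    moreover have "B0 \<in> {B \<in> \<B>. p \<in> B \<and> z \<in> B}" using B0 p z by simp
    ultimately show ?thesis using finB card_gt_0_iff by fastforce
  qed
  have const: "card (B \<inter> cell i x) = card (B0 \<inter> cell i p)" if "i \<le> s" "B \<in> \<B>" "x \<in> B" for i B x
  proof -
    have flags: "(p, B0) \<in> flags P \<B>" "(x, B) \<in> flags P \<B>"
      using B0 p pP that BP unfolding flags_def by auto
    obtain g where g: "g \<in> G" "g p = x" "g ` B0 = B"
      using bspec[OF bspec[OF ft[unfolded flag_transitive_def split_beta] flags(1)] flags(2)]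
      by auto
    have "g \<in> Bij P" using subgroup.subset[OF G] g(1) unfolding design_Aut_def by auto
    then have inj: "inj_on g P" unfolding Bij_def bij_betw_def by auto
    have "bij_betw ((`) g) (C i) (C i)"
      using pres g(1) \<open>i \<le> s\<close> unfolding preserves_partition_def by auto
    then have "g ` cell i p \<in> C i"
      using cell_in_level(1)[OF \<open>i \<le> s\<close> pP] by (rule bij_betw_apply)
    moreover have "x \<in> g ` cell i p" using g(2) cell_in_level(2)[OF \<open>i \<le> s\<close> pP] by blast
    ultimately have "cell i x = g ` cell i p" by (rule cell_eq[OF \<open>i \<le> s\<close>])
    then have "B \<inter> cell i x = g ` (B0 \<inter> cell i p)"
      using inj_on_image_Int[OF inj BP[OF B0] cell_subset[OF \<open>i \<le> s\<close>]] g(3) by simp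
    moreover have "inj_on g (B0 \<inter> cell i p)"
      using inj BP[OF B0] by (meson inf_le1 inj_on_subset order_trans)
    ultimately show ?thesis by (simp add: card_image)
  qed
  define Y where "Y i = card (B0 \<inter> cell i p)" for i
  have unif: "uniform Y B" if "B \<in> \<B>" for B
    using const that BP Bk[OF that] k unfolding uniform_def Y_def by auto
  define r where "r = card {B \<in> \<B>. p \<in> B}"
  have rY: "r * (Y i - 1) = lam * (?c i - 1)" if i: "i \<le> s" for i
  proof -
    have pc: "p \<in> cell i p" using cell_in_level i pP by auto
    let ?S = "cell i p - {p}"
    have "lam * (?c i - 1) = (\<Sum>w\<in>?S. card {B \<in> \<B>. p \<in> B \<and> w \<in> B})"
      using lam[OF pP] cell_subset[OF i, of p] card_cell[OF i pP] pc finite_cell[OF i, of p]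
      by (subst sum.cong[OF refl, of _ _ "\<lambda>_. lam"]) auto
    also have "\<dots> = (\<Sum>B\<in>{B \<in> \<B>. p \<in> B}. card (B \<inter> ?S))"
      using sum_card_blocks[OF finB] finite_cell[OF i] by blast
    also have "\<dots> = (\<Sum>B\<in>{B \<in> \<B>. p \<in> B}. Y i - 1)"
    proof (rule sum.cong)
      fix B assume B: "B \<in> {B \<in> \<B>. p \<in> B}"
      have "B \<inter> ?S = (B \<inter> cell i p) - {p}" by auto
      moreover have "p \<in> B \<inter> cell i p" using B pc by auto
      ultimately show "card (B \<inter> ?S) = Y i - 1"
        using const[OF i, of B p] B finite_cell[OF i] unfolding Y_def by simp
    qed simp
    finally show ?thesis unfolding r_def by simp
  qed
  have Ys: "Y s = k" using uniform_card[OF unif[OF B0]] Bk[OF B0] by simp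
  have cs: "?c s = v" using card_cell[OF order_refl pP] cell_top[OF pP] card_P by simp
  have rk: "r * (k - 1) = lam * (v - 1)" using rY[OF order_refl] Ys cs by simp
  have "r > 0" using rk \<open>lam > 0\<close> v by (cases r) auto
  have "(v - 1) * Y i + (k - 1) = (v - 1) + (k - 1) * ?c i" if i: "i \<le> s" for i
  proof -
    have "r * ((v - 1) * (Y i - 1)) = r * ((k - 1) * (?c i - 1))"
      using rY[OF i] rk by (metis mult.assoc mult.commute)
    then have "(v - 1) * (Y i - 1) = (k - 1) * (?c i - 1)" using \<open>r > 0\<close> by simp
    moreover have "Y i \<ge> 1" using uniform_pos[OF unif[OF B0] i] by simp
    moreover have "?c i \<ge> 1" 
    proof -
      have "P \<noteq> {}" using pP by auto
      then have "?c i > 0" using uniform_pos[OF uniform_P i] by blast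
      then show ?thesis by linarith
    qed
    ultimately show ?thesis by (auto simp: le_iff_add)
  qed
  then show ?thesis using that unif by blast
qed

end

section \<open>Arithmetic of the parameters\<close>

text \<open>Here \<open>n\<close> and \<open>l\<close> stand for \<open>v - 1\<close> and
  \<open>k - 1\<close>, and \<open>c\<close> for a class size. Then \<open>Y = 1 + T * q\<close> is
  coprime to \<open>T\<close>, and \<open>Y' = Y + T * (c * p)\<close>, so \<open>Y\<close> divides
  \<open>Y'\<close> exactly when it divides \<open>c * p\<close>.\<close>

lemma dvd_step_iff:
  fixes n l d T c e p q Y Y' :: nat
  assumes "n > 0" "d > 0" and T: "l * d = n * T"
    and Y: "n * Y + l = n + l * c" and Y': "n * Y' + l = n + l * (c * e)"
    and c: "c = 1 + d * q" and e: "e = 1 + d * p"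
  shows "Y dvd Y' \<longleftrightarrow> Y dvd ((e - 1) * c) div d"
proof -
  have "n * Y + l = n * (1 + T * q) + l"
    using Y T unfolding c by (simp add: algebra_simps)
  then have Yq: "Y = 1 + T * q" using \<open>n > 0\<close> by (metis add_right_cancel mult_cancel1 not_gr0)
  have "n * Y' + l = (n * Y + l) + (l * d) * (c * p)"
    using Y Y' unfolding e by (simp add: algebra_simps)
  then have "n * Y' = n * (Y + T * (c * p))" unfolding T by (simp add: algebra_simps)
  then have "Y' = Y + T * (c * p)" using \<open>n > 0\<close> by simp
  then have "Y dvd Y' \<longleftrightarrow> Y dvd T * (c * p)" by simp
  also have "\<dots> \<longleftrightarrow> Y dvd c * p"
  proof (rule coprime_dvd_mult_right_iff)
    show "coprime Y T"
    proof (rule coprimeI)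
      fix a assume "a dvd Y" "a dvd T"
      then show "is_unit a" unfolding Yq by (metis dvd_add_left_iff dvd_mult2)
    qed
  qed
  also have "c * p = ((e - 1) * c) div d"
    using \<open>d > 0\<close> unfolding e by (simp add: mult.assoc mult.commute[of c p])
  finally show ?thesis .
qed

text \<open>Multiplying the identity for \<open>Y\<close> by \<open>p\<close> and eliminating
  \<open>l * c * p\<close> leaves \<open>l * p\<close> as a difference of two multiples of
  \<open>n\<close>. With \<open>p = e i - 1\<close> this leads to \<open>FT1\<close>.\<close>

lemma dvd_of_consecutive:
  fixes n l c p Y Y' :: nat
  assumes Y: "n * Y + l = n + l * c" and Y': "n * Y' + l = n + l * (c * (1 + p))"
  shows "n dvd l * p"
proof -
  have "n * Y' + l = n + l * c + l * c * p" using Y' by (simp add: algebra_simps)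
  then have 1: "n * Y' = n * Y + l * c * p" using Y by simp
  have "n * Y * p + l * p = n * p + l * c * p" using Y by (metis add_mult_distrib)
  then have "n * (Y + Y * p) + l * p = n * (Y' + p)" using 1 by (simp add: algebra_simps)
  then show ?thesis by (metis dvd_add_right_iff dvd_triv_left)
qed

lemma prod_one_mod:
  fixes e :: "nat \<Rightarrow> nat"
  assumes "\<And>j. j \<in> {1..i} \<Longrightarrow> \<exists>p. e j = 1 + d * p"
  shows "\<exists>q. (\<Prod>j=1..i. e j) = 1 + d * q"
  using assms
proof (induction i)
  case 0
  then show ?case by (auto intro: exI[of _ 0])
next
  case (Suc i)
  then obtain p q where "(\<Prod>j=1..i. e j) = 1 + d * q" "e (Suc i) = 1 + d * p"
    by (metis Suc_leD atLeastAtMost_iff le_Suc_eq le_add1 order_refl plus_1_eq_Suc)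
  then have "(\<Prod>j=1..Suc i. e j) = 1 + d * (q + p + d * p * q)"
    by (simp add: algebra_simps)
  then show ?case by blast
qed

theorem theorem1p2:
  fixes s k v d :: nat and e :: "nat \<Rightarrow> nat" and y :: "nat \<Rightarrow> real"
    and P :: "'a set" and C :: "nat \<Rightarrow> 'a set set"
  assumes "s \<ge> 2" and "k \<ge> 2" and "\<forall>i\<in>{1..s}. e i \<ge> 2"
    and "v = (\<Prod>i=1..s. e i)" and "k < v"
    and "finite P" and "card P = v"
    and "partition_chain P s e C"
    and "d = Gcd ((\<lambda>i. e i - 1) ` {1..s})"
    and "\<forall>i\<in>{1..s}. y i = 1 + (real k - 1) / (real v - 1) * (real (\<Prod>j=1..i. e j) - 1)"
  shows "((\<exists>\<B> lam G. two_design P \<B> v k lam \<and> subgroup G (design_Aut P \<B>) \<and>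
              flag_transitive G P \<B> \<and> (\<forall>i\<in>{0..s}. preserves_partition G (C i)))
            \<longleftrightarrow> FT1 v k d \<and> FT2 s e d y) \<and>
         (FT1 v k d \<and> FT2 s e d y \<longrightarrow>
            (\<forall>\<B> lam G. two_design P \<B> v k lam \<and> subgroup G (design_Aut P \<B>) \<and>
                flag_transitive G P \<B> \<and> (\<forall>i\<in>{0..s}. preserves_partition G (C i)) \<longrightarrow>
              (\<forall>i\<in>{1..s}. \<forall>X \<in> C i. \<forall>B\<in>\<B>. real (card (B \<inter> X)) \<in> {0, y i})))"
    (is "((\<exists>\<B> lam G. ?design \<B> lam G) \<longleftrightarrow> ?FT) \<and> (_ \<longrightarrow> ?inter)")
proof -
  interpret partition_tower P s e C using assms(6,8) by unfold_locales
  let ?c = "\<lambda>i. \<Prod>j=1..i. e j"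
  let ?eq = "\<lambda>Y i. (v - 1) * Y i + (k - 1) = (v - 1) + (k - 1) * ?c i"
  have v: "v > 1" using assms(2,5) by simp
  have ddvd: "d dvd e j - 1" if "j \<in> {1..s}" for j using that assms(9) by auto
  have ep: "\<exists>p. e j = 1 + d * p" if j: "j \<in> {1..s}" for j
  proof -
    obtain p where "e j - 1 = d * p" using ddvd[OF j] by (auto elim: dvdE)
    moreover have "e j \<ge> 2" using assms(3) j by simp
    ultimately have "e j = 1 + d * p" by linarith
    then show ?thesis by blast
  qed
  have "e 1 - 1 > 0" using assms(1,3) by force
  then have d: "d > 0" using ddvd[of 1] assms(1) by (auto intro: Nat.gr0I)
  \<comment> \<open>Connects the additive identity over the naturals with the real formula that
    defines \<open>y i\<close>.\<close>
  have Y_iff: "?eq Y i \<longleftrightarrow> real (Y i) = 1 + (real k - 1) / (real v - 1) * (real (?c i) - 1)"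
    for Y :: "nat \<Rightarrow> nat" and i
  proof -
    have "?eq Y i \<longleftrightarrow> (real v - 1) * real (Y i) + (real k - 1) = (real v - 1) + (real k - 1) * real (?c i)"
    proof -
      have "?eq Y i \<longleftrightarrow>
          real ((v - 1) * Y i + (k - 1)) = real ((v - 1) + (k - 1) * ?c i)"
        by (simp only: of_nat_eq_iff)
      moreover have "real (v - 1) = real v - 1" "real (k - 1) = real k - 1"
        using v assms(2) by (simp_all add: of_nat_diff)
      ultimately show ?thesis by (simp only: of_nat_add of_nat_mult)
    qed
    also have "\<dots> \<longleftrightarrow> real (Y i) = 1 + (real k - 1) / (real v - 1) * (real (?c i) - 1)"
      using v by (auto simp: field_simps simp del: of_nat_prod)
    finally show ?thesis .
  qed
  have step_iff: "Y i dvd Y (Suc i) \<longleftrightarrow> Y i dvd ((e (i + 1) - 1) * ?c i) div d"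
    if less: "i < s" and eqs: "?eq Y i" "?eq Y (Suc i)" and FT1: "FT1 v k d" for Y :: "nat \<Rightarrow> nat" and i
  proof -
    obtain T where "(k - 1) * d = (v - 1) * T" using FT1 unfolding FT1_def by (auto elim: dvdE)
    moreover obtain q where "?c i = 1 + d * q" using prod_one_mod[of i e d] ep less by auto
    moreover obtain p where "e (Suc i) = 1 + d * p" using ep[of "Suc i"] less by auto
    moreover have "?c (Suc i) = ?c i * e (Suc i)" by simp
    ultimately show ?thesis
      using dvd_step_iff[of "v - 1" d "k - 1" T "Y i" "?c i" "Y (Suc i)" "e (Suc i)" q p] eqs v d
      by simp
  qed
  \<comment> \<open>The intersection sizes are obtained along with the arithmetic conditions, so
    this covers one direction and the final claim at once.\<close>
  have necessary: "?FT \<and> (\<forall>i\<in>{1..s}. \<forall>X \<in> C i. \<forall>B\<in>\<B>. real (card (B \<inter> X)) \<in> {0, y i})"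
    if des: "?design \<B> lam G" for \<B> lam G
  proof -
    obtain Y where unif: "\<And>B. B \<in> \<B> \<Longrightarrow> uniform Y B" and eq: "\<And>i. i \<le> s \<Longrightarrow> ?eq Y i"
      using flag_transitive_design_uniform[of \<B> v k lam G] des assms(2) v by metis
    obtain B where B: "B \<in> \<B>" using des unfolding two_design_def by auto
    have y: "y i = real (Y i)" if "i \<in> {1..s}" for i
      using Y_iff[of Y i] eq[of i] assms(10) that by (simp del: of_nat_prod)
    have "(v - 1) dvd (k - 1) * (e i - 1)" if i: "i \<in> {1..s}" for i
    proof -
      obtain m where m: "i = Suc m" using i by (cases i) auto
      have "e i \<ge> 1" using assms(3) i by force
      then show ?thesis
        using dvd_of_consecutive[of "v - 1" "Y m" "k - 1" "?c m" "Y i" "e i - 1"] eq[of m] eq[of i] i m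
        by simp
    qed
    \<comment> \<open>A common divisor of all \<open>(k - 1) * (e i - 1)\<close> divides their gcd,
      which is \<open>(k - 1) * d\<close>.\<close>
    then have "(v - 1) dvd Gcd ((*) (k - 1) ` (\<lambda>i. e i - 1) ` {1..s})"
      by (intro Gcd_greatest) auto
    then have FT1: "FT1 v k d" unfolding FT1_def assms(9) by (simp add: Gcd_mult)
    have "FT2 s e d y"
      unfolding FT2_def
    proof
      fix i assume i: "i \<in> {1..s - 1}"
      then have "i < s" "i \<in> {1..s}" by auto
      then show "\<exists>m::nat. m > 0 \<and> y i = real m \<and> m dvd ((e (i + 1) - 1) * ?c i) div d"
        using y step_iff[of i Y] eq FT1 uniform_dvd[OF unif[OF B]] uniform_pos[OF unif[OF B]]
        by (intro exI[of _ "Y i"]) auto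
    qed
    moreover have "real (card (D \<inter> X)) \<in> {0, y i}" if "i \<in> {1..s}" "X \<in> C i" "D \<in> \<B>" for i X D
    proof (cases "D \<inter> X = {}")
      case False
      then obtain x where x: "x \<in> D" "x \<in> X" by auto
      then have "cell i x = X" using cell_eq that by auto
      then show ?thesis using y unif[OF that(3)] x(1) that(1) unfolding uniform_def by auto
    qed simp
    ultimately show ?thesis using FT1 by blast
  qed
  have sufficient: "\<exists>\<B> lam G. ?design \<B> lam G" if FT: ?FT
  proof -
    \<comment> \<open>\<open>y\<close> is prescribed only on \<open>{1..s}\<close>; \<open>f\<close>
      is the same formula, also at level \<open>0\<close>, where its value is
      \<open>1\<close>.\<close>
    define f where "f i = 1 + (real k - 1) / (real v - 1) * (real (?c i) - 1)" for i
    have fs: "f s = real k" unfolding f_def assms(4)[symmetric] using v by simp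
    have "\<exists>m. m > 0 \<and> real m = f i" if i: "i \<le> s" for i
    proof -
      \<comment> \<open>The end levels have the values \<open>1\<close> and \<open>k\<close>;
        integrality at the inner levels comes from \<open>FT2\<close>.\<close>
      have "i = 0 \<or> i = s \<or> i \<in> {1..s - 1}" using i by auto
      then consider "i = 0" | "i = s" | "i \<in> {1..s - 1}" by blast
      then show ?thesis
      proof cases
        case 1
        then show ?thesis unfolding f_def by (intro exI[of _ 1]) simp
      next
        case 2
        then show ?thesis using fs assms(2) by (intro exI[of _ k]) simp
      next
        case 3
        then have "y i = f i" using assms(10) unfolding f_def by auto
        then show ?thesis using FT 3 unfolding FT2_def by metis
      qed
    qed
    then obtain Y where Y: "\<And>i. i \<le> s \<Longrightarrow> Y i > 0" "\<And>i. i \<le> s \<Longrightarrow> real (Y i) = f i" by metis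
    then have eq: "?eq Y i" if "i \<le> s" for i using Y_iff[of Y i] that unfolding f_def by blast
    have Y0: "Y 0 = 1" using Y(2)[of 0] unfolding f_def by simp
    have Ys: "Y s = k" using Y(2)[of s] fs by simp
    have dvd: "Y i dvd Y (Suc i)" if "i < s" for i
    proof (cases "i = 0")
      case False
      then have i: "i \<in> {1..s - 1}" "i \<in> {1..s}" using that by auto
      then obtain m where "y i = real m" "m dvd ((e (i + 1) - 1) * ?c i) div d"
        using FT unfolding FT2_def by blast
      moreover have "y i = real (Y i)" using Y(2)[of i] assms(10) i unfolding f_def by auto
      ultimately show ?thesis using step_iff[OF that] eq FT that by auto
    qed (simp add: Y0)
    have le: "Y (Suc i) \<le> e (Suc i) * Y i" if "i < s" for i
    proof -
      have "e (Suc i) \<ge> 1" using bspec[OF assms(3), of "Suc i"] that by simp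
      define t where "t = (real k - 1) / (real v - 1)"
      have t: "t \<le> 1" unfolding t_def using assms(5) v by simp
      \<comment> \<open>The gap factors, and \<open>k < v\<close> makes the second factor
        nonnegative; thus a class has enough subclasses for the construction.\<close>
      have "real (e (Suc i) * Y i) - real (Y (Suc i)) = (real (e (Suc i)) - 1) * (1 - t)"
      proof -
        have Y_eq: "real (Y i) = 1 + t * (real (?c i) - 1)"
          "real (Y (Suc i)) = 1 + t * (real (?c i) * real (e (Suc i)) - 1)"
          using Y(2)[of i] Y(2)[of "Suc i"] that unfolding f_def t_def by simp_all
        show ?thesis unfolding of_nat_mult Y_eq by (simp add: algebra_simps del: of_nat_prod)
      qed
      also have "\<dots> \<ge> 0" using t \<open>e (Suc i) \<ge> 1\<close> by simp
      finally have "real (Y (Suc i)) \<le> real (e (Suc i) * Y i)" by simp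
      then show ?thesis by (simp only: of_nat_le_iff)
    qed
    have "P \<noteq> {}" using v assms(7) by auto
    then obtain B0 where "uniform Y B0" using uniform_exists[OF Y0 Y(1) dvd le] by blast
    note des = uniform_sets_design[OF this assms(7) v Ys eq]
    then show ?thesis using preserves_partition_tower_group by (meson atLeastAtMost_iff)
  qed
  show ?thesis using necessary sufficient by blast
qed

end
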